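(* Let $r\in(0,1)$ be a constant with the property stated in the context. Let $$\begin{pmatrix}\alpha&\gamma\\ \beta&\delta\end{pmatrix},\qquad \begin{pmatrix}\xi_1&\xi_2\\ \eta_1&\eta_2\end{pmatrix}\in \mathrm{SL}_2(\mathbb{R}),$$ with $\delta\neq 0$ and $\beta/\delta\notin\mathbb{Q}$. Let $\psi(t)$ be a function decreasing to zero as $t\to+\infty$ with $\psi(t)=O(t^{-1})$, and let $\rho$ be the inverse function of $t\mapsto 1/\psi(t)$. Suppose that $$\min_{p\in\mathbb{Z}}|(\beta/\delta)q-p|\ge\psi(q)\quad\text{for all } q=1,2,3,\dots.$$ Then there exists a constant $C>0$ such that for every $T\ge1$ there exist a matrix $L=\begin{pmatrix}l_1^1&l_1^2\\ l_2^1&l_2^2\end{pmatrix}\in\mathrm{SL}_2(\mathbb{Z})$ and a real $t$ with $1\le|t|\le T$ such that $$\left\|\begin{pmatrix}1&t\\0&1\end{pmatrix}\begin{pmatrix}\alpha&\gamma\\ \beta&\delta\end{pmatrix}L-\begin{pmatrix}\xi_1&\xi_2\\ \eta_1&\eta_2\end{pmatrix}\right\|\le C\,T^{\frac{r}{1+r}}\Big/\rho\!\left(T^{\frac{1}{1+r}}\right),$$ where $\|\cdot\|$ denotes the maximum of the absolute values of the entries of a matrix.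
   Context: The constant $r\in(0,1)$ is assumed to have the following property: for every $\rho>0$, every (large) $Q$ and all reals $A_1,B_1$ with $A_1,B_1\asymp Q$ (i.e. comparable to $Q$ up to positive multiplicative constants), setting $A_2=-\rho A_1$, $B_2=-\rho B_1$, the equation $xy-zw=1$ has a solution $x,y,z,w\in\mathbb{Z}$ with $|x-A_1|\le Q^r$, $|z-B_1|\le Q^r$, $|y-A_2|\le Q^r$, $|w-B_2|\le Q^r$.
   Formalization: In the property of r, w is paired with A_2 and y with B_2; as printed, no r<1 has it (A_1=2Q, B_1=Q gives xy-zw≈-3ρQ²). "Large Q" means Q beyond a bound uniform for ρ in compact subsets of (0,∞) and depending on the constants in A_1,B_1≍Q. *)

theory Defs
  imports "HOL-Analysis.Analysis"
begin

definition mat2 :: "'a \<Rightarrow> 'a \<Rightarrow> 'a \<Rightarrow> 'a \<Rightarrow> 'a::zero^2^2" where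
  "mat2 a b c d = vector [vector [a, b], vector [c, d]]"

definition max_norm :: "real^2^2 \<Rightarrow> real" where
  "max_norm A = Max {\<bar>A $ i $ j\<bar> | i j. True}"

(* A solution of x y - z w = 1 near (A1, B1, A2, B2) with A2 = - rho A1 and B2 = - rho B1 is the
   integer matrix with rows (x, z), (w, y) of determinant 1, whose columns (x, w) and (z, y) are
   close to the proportional vectors (A1, A2) and (B1, B2); thus w is paired with A2 and y with B2,
   so that the main terms A1 B2 and B1 A2 of x y and z w cancel. With y paired with A2 and w
   with B2 they do not cancel and no r < 1 has the property: see
   crossed_approximation_property_unsatisfiable below.

   "A1, B1 comparable to Q" is c1 Q <= A1, B1 <= c2 Q for arbitrary constants c1, c2 > 0.
   "Large Q" is uniform for rho in compact subsets of (0, oo), as rho varies with Q when the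
   property is applied; it cannot be uniform for all rho > 0, since for rho much larger than
   Q^(1 + r) the fraction x / z would have to approximate A1 / B1 better than fractions with
   denominators of order Q do in general. *)

definition approximation_property :: "real \<Rightarrow> bool" where
  "approximation_property r \<longleftrightarrow>
     (\<forall>\<rho>1>0. \<forall>\<rho>2>0. \<forall>c1>0. \<forall>c2>0. \<forall>\<^sub>F Q in at_top. \<forall>\<rho> A1 B1 A2 B2 :: real.
        \<rho>1 \<le> \<rho> \<and> \<rho> \<le> \<rho>2 \<and>
        c1 * Q \<le> A1 \<and> A1 \<le> c2 * Q \<and> c1 * Q \<le> B1 \<and> B1 \<le> c2 * Q \<and>
        A2 = - \<rho> * A1 \<and> B2 = - \<rho> * B1 \<longrightarrow>
        (\<exists>x y z w :: int. x * y - z * w = 1 \<and>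
           \<bar>of_int x - A1\<bar> \<le> Q powr r \<and> \<bar>of_int z - B1\<bar> \<le> Q powr r \<and>
           \<bar>of_int w - A2\<bar> \<le> Q powr r \<and> \<bar>of_int y - B2\<bar> \<le> Q powr r))"

(* Unsatisfiable even when "large Q" may depend on rho. *)
lemma crossed_approximation_property_unsatisfiable:
  assumes "r < 1"
  shows "\<not> (\<forall>\<rho>>0. \<forall>c1>0. \<forall>c2>0. \<forall>\<^sub>F Q in at_top. \<forall>A1 B1 A2 B2 :: real.
        c1 * Q \<le> A1 \<and> A1 \<le> c2 * Q \<and> c1 * Q \<le> B1 \<and> B1 \<le> c2 * Q \<and>
        A2 = - \<rho> * A1 \<and> B2 = - \<rho> * B1 \<longrightarrow>
        (\<exists>x y z w :: int. x * y - z * w = 1 \<and>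
           \<bar>of_int x - A1\<bar> \<le> Q powr r \<and> \<bar>of_int z - B1\<bar> \<le> Q powr r \<and>
           \<bar>of_int y - A2\<bar> \<le> Q powr r \<and> \<bar>of_int w - B2\<bar> \<le> Q powr r))"
    (is "\<not> (\<forall>\<rho>>0. \<forall>c1>0. \<forall>c2>0. \<forall>\<^sub>F Q in at_top. ?P \<rho> c1 c2 Q)")
proof
  assume "\<forall>\<rho>>0. \<forall>c1>0. \<forall>c2>0. \<forall>\<^sub>F Q in at_top. ?P \<rho> c1 c2 Q"
  then have "\<forall>\<^sub>F Q in at_top. ?P 1 1 2 Q"
    by - (drule spec[of _ 1], drule mp, simp, drule spec[of _ 1], drule mp, simp,
          drule spec[of _ 2], drule mp, simp, assumption)
  moreover have "((\<lambda>Q. Q powr (r - 1)) \<longlongrightarrow> 0) at_top"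
    using assms by (intro tendsto_neg_powr filterlim_ident) auto
  then have "\<forall>\<^sub>F Q in at_top. Q powr (r - 1) < (1 / 10 :: real)"
    by (rule order_tendstoD) simp
  ultimately have "\<forall>\<^sub>F Q in at_top. ?P 1 1 2 Q \<and> Q powr (r - 1) < 1 / 10 \<and> 1 \<le> Q"
    using eventually_ge_at_top[of "1::real"] by eventually_elim auto
  then obtain Q where P: "?P 1 1 2 Q" and small: "Q powr (r - 1) < 1 / 10" and Q: "1 \<le> Q"
    using eventually_happens'[OF trivial_limit_at_top_linorder] by blast
  have e: "Q powr r \<le> Q / 10"
    using small Q by (simp add: powr_diff field_simps)
  from P[rule_format, of "2 * Q" Q "- (2 * Q)" "- Q"] Q
  obtain x y z w :: int where eq: "x * y - z * w = 1"
    and b: "\<bar>of_int x - 2 * Q\<bar> \<le> Q powr r" "\<bar>of_int z - Q\<bar> \<le> Q powr r"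
      "\<bar>of_int y + 2 * Q\<bar> \<le> Q powr r" "\<bar>of_int w + Q\<bar> \<le> Q powr r"
    by auto
  have "(19/10 * Q) * (19/10 * Q) \<le> of_int x * (- of_int y)"
    using b e Q by (intro mult_mono) auto
  moreover have "of_int z * (- of_int w) \<le> (11/10 * Q) * (11/10 * Q)"
    using b e Q by (intro mult_mono) auto
  moreover have "real_of_int x * of_int y - of_int z * of_int w = 1"
    using eq by (metis of_int_1 of_int_diff of_int_mult)
  moreover have "0 \<le> Q * Q" by simp
  ultimately show False by (simp add: algebra_simps)
qed

(* rho is the inverse function of t |-> 1 / psi t. Since psi may be given on [1, oo) only and need
   not be continuous, 1 / psi need not attain every s >= 1; at values it does not attain rho
   may be any positive nondecreasing extension. If 1 / psi does attain every s >= 1 on a larger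
   domain such as (0, oo), the inverse function is of this kind: see
   reciprocal_inverseI below. *)

definition reciprocal_inverse :: "(real \<Rightarrow> real) \<Rightarrow> (real \<Rightarrow> real) \<Rightarrow> bool" where
  "reciprocal_inverse \<psi> \<rho> \<longleftrightarrow>
     (\<forall>t\<ge>1. \<rho> (1 / \<psi> t) = t) \<and> mono_on {1..} \<rho> \<and> (\<forall>s\<ge>1. \<rho> s > 0)"

lemma reciprocal_inverseI:
  assumes decr: "strict_antimono_on {0<..} \<psi>"
    and pos: "\<And>t. t > 0 \<Longrightarrow> \<psi> t > 0" and le1: "\<psi> 1 \<le> 1"
    and inv: "\<And>s. s \<ge> 1 \<Longrightarrow> \<rho> s > 0 \<and> 1 / \<psi> (\<rho> s) = s"
  shows "reciprocal_inverse \<psi> \<rho>"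
  unfolding reciprocal_inverse_def
proof (intro conjI allI impI mono_onI)
  have less: "\<psi> v < \<psi> u" if "0 < u" "u < v" for u v
    using decr that by (auto simp: monotone_on_def)
  show "\<rho> s > 0" if "1 \<le> s" for s using inv that by blast
  show "\<rho> (1 / \<psi> t) = t" if t: "1 \<le> t" for t
  proof -
    have "\<psi> t \<le> 1" using less[of 1 t] le1 t by (cases "t = 1") auto
    then have "1 \<le> 1 / \<psi> t" using pos[of t] t by simp
    note i = inv[OF this]
    then have "\<psi> (\<rho> (1 / \<psi> t)) = \<psi> t" by (metis inverse_eq_divide inverse_inverse_eq)
    then show ?thesis using less i t
      by (metis less_irrefl less_le_trans linorder_neqE_linordered_idom zero_less_one)
  qed
  show "\<rho> s \<le> \<rho> s'" if "s \<in> {1..}" "s \<le> s'" for s s'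
  proof (rule ccontr)
    assume "\<not> \<rho> s \<le> \<rho> s'"
    moreover have i: "\<rho> s' > 0 \<and> 1 / \<psi> (\<rho> s') = s'" "\<rho> s > 0 \<and> 1 / \<psi> (\<rho> s) = s"
      using inv that by auto
    ultimately have "\<psi> (\<rho> s) < \<psi> (\<rho> s')" using less by auto
    then have "1 / \<psi> (\<rho> s') < 1 / \<psi> (\<rho> s)" using pos i by (intro divide_strict_left_mono) auto
    then show False using i that by simp
  qed
qed

end

(* Every L = M N with M, N in SL_2(Z) for which the second row (beta, delta) M is small and the
   columns of N are nearly proportional gives a second row (beta, delta) L = (beta, delta) M N close
   to (eta1, eta2). With X = T^(1/(1+r)), Dirichlet's theorem yields a column (q, -p) of M with
   q <= 2 X and |q beta/delta - p| < 1/X, and the lower bound psi forces q >= rho(X); completing it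
   to a basis, both entries of (beta, delta) M are O(1/q). The approximation property at scale q,
   with proportionality factor close to m11/m12, provides N with error O(q^r), so the second
   row is off by O(q^r / q) while m11 n11 + m12 n21, hence t, has only order q^(1+r). The unipotent
   parameter t then matches the first row. Two points need care:
   - |t| <= T and |t| >= 1 need explicit constants, as rho need not be doubling and X cannot be
     rescaled. The upper bound is bought by applying the property at a small multiple of q, the
     lower one by perturbing m11/m12.
   - The property needs eta1, eta2 > 0, which is reached by right multiplication with a fixed
     element of SL_2(Z). *)
theory Submission
  imports Defs "HOL-Number_Theory.Cong"
begin

section \<open>Rational approximation of \<beta> / \<delta> and its completion to a unimodular
  matrix\<close>

text \<open>\<open>q'\<close> is determined only modulo \<open>q\<close>, as minus an inverse of
  \<open>p\<close>, so it has a representative in this range. The range bounds the ratio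
  \<open>m11 / m12\<close> below, as the approximation property is uniform only for factors in a
  compact set.\<close>

lemma coprime_bezout_in_range:
  fixes p q :: int
  assumes "coprime p q" and "q > 0"
  obtains p' q' where "q * p' - q' * p = 1" "q \<le> q'" "q' \<le> 2 * q"
proof -
  from assms(1) obtain x where "[p * x = 1] (mod q)"
    using cong_solve_coprime_int by blast
  then have "[p * (q + (- x) mod q) = - 1] (mod q)"
    by (simp add: cong_def mod_simps distrib_left)
       (metis mod_minus_cong)
  then have "q dvd 1 + (q + (- x) mod q) * p"
    by (metis add.commute cong_iff_dvd_diff diff_minus_eq_add mult.commute)
  then obtain p' where "1 + (q + (- x) mod q) * p = q * p'" ..
  moreover have "0 \<le> (- x) mod q" "(- x) mod q < q"
    using assms(2) by simp_all
  ultimately show thesis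
    using that[of p' "q + (- x) mod q"] by simp
qed

text \<open>Up to sign, the second column is a Dirichlet approximation \<open>(q, -p)\<close> and
  the first its Bezout partner \<open>(q', -p')\<close>. As \<open>q'\<close> has the order of
  \<open>q\<close>, unimodularity makes the linear form at the partner O(1/q) too.\<close>

lemma unimodular_approximation:
  fixes \<beta> \<delta> X :: real
  assumes "\<delta> \<noteq> 0" and "X \<ge> 1"
  obtains m11 m12 m21 m22 p :: int
  where "m11 * m22 - m12 * m21 = 1" "\<delta> * m12 < 0"
    "1 \<le> real_of_int m11 / m12" "real_of_int m11 / m12 \<le> 2" "\<bar>m12\<bar> \<le> 2 * X"
    "\<bar>\<beta> / \<delta> * of_int \<bar>m12\<bar> - of_int p\<bar> < 1 / X"
    "\<bar>\<beta> * m11 + \<delta> * m21\<bar> \<le> 5 * \<bar>\<delta>\<bar> / \<bar>m12\<bar>"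
    "\<bar>\<beta> * m12 + \<delta> * m22\<bar> \<le> 5 * \<bar>\<delta>\<bar> / \<bar>m12\<bar>"
proof -
  define \<theta> where "\<theta> = \<beta> / \<delta>"
  define N where "N = nat \<lceil>X\<rceil>"
  have N: "N > 0" "X \<le> N" "N \<le> 2 * X"
    using assms(2) unfolding N_def by linarith+
  obtain p q :: int where pq: "coprime p q" "0 < q" "q \<le> int N" "\<bar>of_int q * \<theta> - of_int p\<bar> < 1 / N"
    using Dirichlet_approx_coprime[OF N(1)] by metis
  have q2: "q \<le> 2 * X" using pq(3) N by linarith
  have "1 / N \<le> 1 / X" using N assms(2) by (intro divide_left_mono) auto
  with pq have err: "\<bar>\<theta> * q - p\<bar> < 1 / X" by (simp add: mult.commute)
  obtain p' q' where bez: "q * p' - q' * p = 1" and q': "q \<le> q'" "q' \<le> 2 * q"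
    using coprime_bezout_in_range pq by metis
  have bez': "real_of_int q * real_of_int p' - real_of_int q' * real_of_int p = 1"
    using bez by (metis of_int_1 of_int_diff of_int_mult)
  \<comment> \<open>Trades 1/X for 2/q, since \<open>q\<close> is the scale at which the
    approximation property is applied.\<close>
  have inv: "1 / X \<le> 2 / q"
    using q2 pq(2) assms(2) by (simp add: field_simps)
  \<comment> \<open>\<open>bez'\<close> replaces \<open>q * p'\<close> by \<open>1 + q' * p\<close>;
    the two resulting terms contribute 4 and 1 to the constant 5.\<close>
  have "\<theta> * q' - p' = (real_of_int q' * (\<theta> * q - p) - 1) / q"
    using bez' pq(2) by (simp add: field_simps)
  also have "\<bar>\<dots>\<bar> \<le> (2 * q * (2 / q) + 1) / q"
  proof -
    have "\<bar>real_of_int q' * (\<theta> * q - p)\<bar> \<le> 2 * q * (2 / q)"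
      unfolding abs_mult using q' pq(2) err inv by (intro mult_mono) auto
    then show ?thesis using pq(2) by (simp add: abs_divide divide_right_mono)
  qed
  finally have err': "\<bar>\<theta> * q' - p'\<bar> \<le> 5 / q" using pq(2) by simp
  have err2: "\<bar>\<theta> * q - p\<bar> \<le> 5 / q"
  proof -
    have "2 / q \<le> (5::real) / q" using pq(2) by (intro divide_right_mono) auto
    then show ?thesis using err inv by linarith
  qed
  \<comment> \<open>Changing the sign of both columns keeps the determinant; this choice makes the
    later targets \<open>- (\<eta> * m12 / \<delta>)\<close> positive for \<eta> > 0.\<close>
  define s :: int where "s = (if \<delta> > 0 then -1 else 1)"
  have s: "s * s = 1" "\<bar>s\<bar> = 1" "\<delta> * s < 0"
    using assms(1) by (auto simp: s_def)
  show thesis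
  proof (rule that[of "s * q'" "- (s * p)" "s * q" "- (s * p')" p])
    have "s * q' * - (s * p) - s * q * - (s * p') = (s * s) * (q * p' - q' * p)"
      by (simp add: algebra_simps)
    then show "s * q' * - (s * p) - s * q * - (s * p') = 1" using bez s(1) by simp
    have "\<delta> * real_of_int (s * q) = (\<delta> * s) * q" by simp
    then show "\<delta> * real_of_int (s * q) < 0" using mult_neg_pos[OF s(3), of "real_of_int q"] pq(2) by simp
    have "s \<noteq> 0" using s(2) by auto
    then show "1 \<le> real_of_int (s * q') / real_of_int (s * q)"
      "real_of_int (s * q') / real_of_int (s * q) \<le> 2"
      using q' pq(2) by (simp_all add: field_simps)
    have a: "\<bar>s * q\<bar> = q" using s(2) pq(2) by (simp add: abs_mult)
    then show "real_of_int \<bar>s * q\<bar> \<le> 2 * X" using q2 by simp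
    show "\<bar>\<beta> / \<delta> * of_int \<bar>s * q\<bar> - of_int p\<bar> < 1 / X"
      using err a by (simp add: \<theta>_def)
    have scale: "\<bar>\<beta> * real_of_int (s * n) + \<delta> * real_of_int (- (s * m))\<bar> = \<bar>\<delta>\<bar> * \<bar>\<theta> * n - m\<bar>"
      for n m :: int
    proof -
      have "\<beta> * real_of_int (s * n) + \<delta> * real_of_int (- (s * m)) = s * (\<delta> * (\<theta> * n - m))"
        using assms(1) by (simp add: \<theta>_def algebra_simps)
      moreover have "\<bar>real_of_int s\<bar> = 1" using s(2) by linarith
      ultimately show ?thesis by (simp add: abs_mult)
    qed
    show "\<bar>\<beta> * real_of_int (s * q') + \<delta> * real_of_int (- (s * p'))\<bar> \<le> 5 * \<bar>\<delta>\<bar> / real_of_int \<bar>s * q\<bar>"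
      unfolding scale a using mult_left_mono[OF err', of "\<bar>\<delta>\<bar>"] by (simp add: mult.commute)
    show "\<bar>\<beta> * real_of_int (s * q) + \<delta> * real_of_int (- (s * p))\<bar> \<le> 5 * \<bar>\<delta>\<bar> / real_of_int \<bar>s * q\<bar>"
      unfolding scale a using mult_left_mono[OF err2, of "\<bar>\<delta>\<bar>"] by (simp add: mult.commute)
  qed
qed

section \<open>Rescaling the approximation property; estimates for one column and for the
  shear\<close>

text \<open>The property is applied at \<nu> Q with \<open>\<nu> powr r = k\<close>; the
  comparability constants become \<open>c1 / \<nu>\<close> and \<open>c2 / \<nu>\<close>, which is
  harmless as they are arbitrary. A small \<open>k\<close> later secures |t| \<le> T.\<close>

lemma approximation_property_scaled:
  assumes "approximation_property r" and "0 < r" and "0 < k"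
    and "0 < \<rho>1" "0 < \<rho>2" "0 < c1" "0 < c2"
  shows "\<forall>\<^sub>F Q in at_top. \<forall>\<rho> A B. \<rho>1 \<le> \<rho> \<and> \<rho> \<le> \<rho>2 \<and>
        c1 * Q \<le> A \<and> A \<le> c2 * Q \<and> c1 * Q \<le> B \<and> B \<le> c2 * Q \<longrightarrow>
        (\<exists>x y z w :: int. x * y - z * w = 1 \<and>
           \<bar>of_int x - A\<bar> \<le> k * Q powr r \<and> \<bar>of_int z - B\<bar> \<le> k * Q powr r \<and>
           \<bar>of_int w + \<rho> * A\<bar> \<le> k * Q powr r \<and> \<bar>of_int y + \<rho> * B\<bar> \<le> k * Q powr r)"
proof -
  define \<nu> where "\<nu> = k powr (1 / r)"
  have \<nu>: "\<nu> > 0" "\<nu> powr r = k"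
    using assms by (auto simp: \<nu>_def powr_powr)
  note p = assms(1)[unfolded approximation_property_def, rule_format, OF assms(4,5),
      of "c1 / \<nu>" "c2 / \<nu>"]
  have "filterlim (\<lambda>Q. \<nu> * Q) at_top at_top"
    using \<nu> by real_asymp
  then have "\<forall>\<^sub>F Q in at_top. \<forall>\<rho> A1 B1 A2 B2 :: real.
        \<rho>1 \<le> \<rho> \<and> \<rho> \<le> \<rho>2 \<and>
        c1 / \<nu> * (\<nu> * Q) \<le> A1 \<and> A1 \<le> c2 / \<nu> * (\<nu> * Q) \<and> c1 / \<nu> * (\<nu> * Q) \<le> B1 \<and> B1 \<le> c2 / \<nu> * (\<nu> * Q) \<and>
        A2 = - \<rho> * A1 \<and> B2 = - \<rho> * B1 \<longrightarrow>
        (\<exists>x y z w :: int. x * y - z * w = 1 \<and>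
           \<bar>of_int x - A1\<bar> \<le> (\<nu> * Q) powr r \<and> \<bar>of_int z - B1\<bar> \<le> (\<nu> * Q) powr r \<and>
           \<bar>of_int w - A2\<bar> \<le> (\<nu> * Q) powr r \<and> \<bar>of_int y - B2\<bar> \<le> (\<nu> * Q) powr r)"
    using p \<nu> assms by (intro eventually_compose_filterlim[where f = "\<lambda>Q. \<nu> * Q"]) auto
  then show ?thesis
    using eventually_gt_at_top[of "0::real"]
  proof eventually_elim
    case (elim Q)
    have e: "(\<nu> * Q) powr r = k * Q powr r"
      using \<nu> elim by (simp add: powr_mult)
    have c: "c / \<nu> * (\<nu> * Q) = c * Q" for c using \<nu> by simp
    show ?case
      using elim(1)[unfolded e c] by (metis (no_types, opaque_lifting) diff_minus_eq_add mult_minus_left)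
  qed
qed

text \<open>One column of the product \<open>M N\<close>. Since \<open>det M = 1\<close>, the main term of the second coordinate
  is exactly \<open>\<eta>\<close>; the shift \<open>\<tau>\<close> only serves to move \<open>m11 * x + m12 * w\<close> away from \<open>0\<close>.\<close>
lemma column_estimate:
  fixes m11 m12 m21 m22 x w A \<beta> \<delta> \<tau> E \<eta> :: real
  assumes det: "m11 * m22 - m12 * m21 = 1" and "\<delta> \<noteq> 0" "m12 \<noteq> 0"
    and A: "A = - (\<eta> * m12 / \<delta>)"
    and x: "\<bar>x - A\<bar> \<le> E" and w: "\<bar>w + (m11 - \<tau>) / m12 * A\<bar> \<le> E"
    and h1: "\<bar>\<beta> * m11 + \<delta> * m21\<bar> \<le> h" and h2: "\<bar>\<beta> * m12 + \<delta> * m22\<bar> \<le> h"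
  shows "\<bar>\<beta> * (m11 * x + m12 * w) + \<delta> * (m21 * x + m22 * w) - \<eta>\<bar>
           \<le> h * (2 * E + \<bar>\<tau>\<bar> * \<bar>\<eta>\<bar> / \<bar>\<delta>\<bar>)"
    and "\<bar>m11 * x + m12 * w - \<tau> * A\<bar> \<le> (\<bar>m11\<bar> + \<bar>m12\<bar>) * E"
proof -
  define e1 e2 where "e1 = x - A" and "e2 = w + (m11 - \<tau>) / m12 * A"
  have e: "\<bar>e1\<bar> \<le> E" "\<bar>e2\<bar> \<le> E" using x w by (auto simp: e1_def e2_def)
  have xw: "x = A + e1" "m12 * w = m12 * e2 - (m11 - \<tau>) * A"
    using assms(3) by (auto simp: e1_def e2_def field_simps)
  let ?h1 = "\<beta> * m11 + \<delta> * m21" and ?h2 = "\<beta> * m12 + \<delta> * m22"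
  have w': "w = e2 + (m11 - \<tau>) * \<eta> / \<delta>"
    using assms(2,3) by (simp add: e2_def A field_simps)
  \<comment> \<open>By this, \<open>m11 * ?h2 - m12 * ?h1 = \<delta>\<close>, so the main terms of
    \<open>x\<close> and \<open>w\<close> sum to \<eta> and only \<open>e1\<close>,
    \<open>e2\<close> and \<tau> leave a remainder.\<close>
  have "m11 * m22 = 1 + m12 * m21" using det by simp
  then have "\<beta> * (m11 * x + m12 * w) + \<delta> * (m21 * x + m22 * w) - \<eta> = ?h1 * e1 + ?h2 * e2 - ?h2 * (\<tau> * \<eta> / \<delta>)"
    unfolding w' xw(1) A using assms(2) by (simp add: field_simps)
  also have "\<bar>\<dots>\<bar> \<le> h * E + h * E + h * (\<bar>\<tau>\<bar> * \<bar>\<eta>\<bar> / \<bar>\<delta>\<bar>)"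
  proof -
    have "\<bar>?h1 * e1\<bar> \<le> h * E" "\<bar>?h2 * e2\<bar> \<le> h * E" "\<bar>?h2 * (\<tau> * \<eta> / \<delta>)\<bar> \<le> h * (\<bar>\<tau>\<bar> * \<bar>\<eta>\<bar> / \<bar>\<delta>\<bar>)"
      unfolding abs_mult abs_divide using h1 h2 e by (auto intro!: mult_mono mult_right_mono divide_right_mono)
    then show ?thesis by linarith
  qed
  finally show "\<bar>\<beta> * (m11 * x + m12 * w) + \<delta> * (m21 * x + m22 * w) - \<eta>\<bar>
           \<le> h * (2 * E + \<bar>\<tau>\<bar> * \<bar>\<eta>\<bar> / \<bar>\<delta>\<bar>)" by (simp add: algebra_simps)
  have "m11 * x + m12 * w - \<tau> * A = m11 * e1 + m12 * e2"
    unfolding xw by (simp add: algebra_simps)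
  also have "\<bar>\<dots>\<bar> \<le> \<bar>m11\<bar> * E + \<bar>m12\<bar> * E"
  proof -
    have "\<bar>m11 * e1\<bar> \<le> \<bar>m11\<bar> * E" "\<bar>m12 * e2\<bar> \<le> \<bar>m12\<bar> * E"
      unfolding abs_mult using e by (auto intro!: mult_left_mono)
    then show ?thesis by linarith
  qed
  finally show "\<bar>m11 * x + m12 * w - \<tau> * A\<bar> \<le> (\<bar>m11\<bar> + \<bar>m12\<bar>) * E"
    by (simp add: algebra_simps)
qed

text \<open>Given the second row, \<open>t\<close> is chosen so that the first entry of the first row is exact; the
  determinant then controls the other one.\<close>
lemma shear_estimate:
  fixes a b c d \<alpha> \<beta> \<gamma> \<delta> \<xi>1 \<xi>2 \<eta>1 \<eta>2 \<epsilon> :: real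
  defines "v1 \<equiv> \<beta> * a + \<delta> * c" and "v2 \<equiv> \<beta> * b + \<delta> * d"
  defines "t \<equiv> (\<xi>1 - (\<alpha> * a + \<gamma> * c)) / v1"
  assumes g: "\<alpha> * \<delta> - \<gamma> * \<beta> = 1" and det: "a * d - b * c = 1" and X: "\<xi>1 * \<eta>2 - \<xi>2 * \<eta>1 = 1"
    and "\<delta> \<noteq> 0" "0 < \<eta>1"
    and e1: "\<bar>v1 - \<eta>1\<bar> \<le> \<epsilon>" and e2: "\<bar>v2 - \<eta>2\<bar> \<le> \<epsilon>" and small: "\<epsilon> \<le> \<eta>1 / 2"
  shows "\<alpha> * a + \<gamma> * c + t * v1 = \<xi>1"
    and "\<bar>\<alpha> * b + \<gamma> * d + t * v2 - \<xi>2\<bar> \<le> 2 * (\<bar>\<xi>1\<bar> + \<bar>\<xi>2\<bar>) / \<eta>1 * \<epsilon>"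
    and "\<bar>t + a / (\<delta> * v1)\<bar> \<le> 2 * \<bar>\<xi>1\<bar> / \<eta>1 + \<bar>\<gamma> / \<delta>\<bar>"
proof -
  have v1: "v1 \<ge> \<eta>1 / 2" "v1 > 0" using e1 small assms(8) by linarith+
  have tv: "t * v1 = \<xi>1 - (\<alpha> * a + \<gamma> * c)" using v1 by (simp add: t_def)
  then show "\<alpha> * a + \<gamma> * c + t * v1 = \<xi>1" by simp
  \<comment> \<open>The product matrix and the target both have determinant 1, so in
    \<open>v1\<close> times the remaining error the constants cancel and only second-row errors
    survive.\<close>
  have "(\<alpha> * a + \<gamma> * c) * v2 - (\<alpha> * b + \<gamma> * d) * v1 = (\<alpha> * \<delta> - \<gamma> * \<beta>) * (a * d - b * c)"
    by (simp add: v1_def v2_def algebra_simps)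
  then have *: "(\<alpha> * a + \<gamma> * c) * v2 - (\<alpha> * b + \<gamma> * d) * v1 = 1" using g det by simp
  have "v1 * (\<alpha> * b + \<gamma> * d + t * v2 - \<xi>2) = (\<alpha> * b + \<gamma> * d) * v1 + (t * v1) * v2 - \<xi>2 * v1"
    by (simp add: algebra_simps)
  also have "\<dots> = \<xi>1 * v2 - 1 - \<xi>2 * v1"
    unfolding tv using * by (simp add: algebra_simps)
  also have "\<dots> = \<xi>1 * (v2 - \<eta>2) - \<xi>2 * (v1 - \<eta>1)"
    using X by (simp add: algebra_simps)
  finally have eq: "\<alpha> * b + \<gamma> * d + t * v2 - \<xi>2 = (\<xi>1 * (v2 - \<eta>2) - \<xi>2 * (v1 - \<eta>1)) / v1"
    using v1 by (simp add: field_simps)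
  have "\<bar>\<xi>1 * (v2 - \<eta>2)\<bar> \<le> \<bar>\<xi>1\<bar> * \<epsilon>" "\<bar>\<xi>2 * (v1 - \<eta>1)\<bar> \<le> \<bar>\<xi>2\<bar> * \<epsilon>"
    unfolding abs_mult using e1 e2 by (auto intro: mult_left_mono)
  then have "\<bar>\<xi>1 * (v2 - \<eta>2) - \<xi>2 * (v1 - \<eta>1)\<bar> \<le> (\<bar>\<xi>1\<bar> + \<bar>\<xi>2\<bar>) * \<epsilon>"
    by (simp add: algebra_simps)
  then have "\<bar>(\<xi>1 * (v2 - \<eta>2) - \<xi>2 * (v1 - \<eta>1)) / v1\<bar> \<le> (\<bar>\<xi>1\<bar> + \<bar>\<xi>2\<bar>) * \<epsilon> / (\<eta>1 / 2)"
    unfolding abs_divide using v1 assms(8) by (intro frac_le) auto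
  then show "\<bar>\<alpha> * b + \<gamma> * d + t * v2 - \<xi>2\<bar> \<le> 2 * (\<bar>\<xi>1\<bar> + \<bar>\<xi>2\<bar>) / \<eta>1 * \<epsilon>"
    unfolding eq by (simp add: mult.commute mult.left_commute)
  \<comment> \<open>This expresses the first-row entry through \<open>a\<close> and
    \<open>v1\<close>. Hence \<open>t\<close> is \<open>- a / (\<delta> * v1)\<close> up to a
    bounded term, and its size can be read off from \<open>a\<close>.\<close>
  have "\<delta> * (\<alpha> * a + \<gamma> * c) = (\<alpha> * \<delta> - \<gamma> * \<beta>) * a + \<gamma> * v1"
    by (simp add: v1_def algebra_simps)
  then have x1: "\<alpha> * a + \<gamma> * c = (a + \<gamma> * v1) / \<delta>"
    using g assms(7) by (metis mult_1 nonzero_mult_div_cancel_left)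
  have "t + a / (\<delta> * v1) = \<xi>1 / v1 - \<gamma> / \<delta>"
    unfolding t_def x1 using v1(2) assms(7) by (simp add: field_simps)
  moreover have "\<bar>\<xi>1 / v1\<bar> \<le> \<bar>\<xi>1\<bar> / (\<eta>1 / 2)"
    unfolding abs_divide using v1 assms(8) by (intro frac_le) auto
  moreover have "\<bar>\<xi>1\<bar> / (\<eta>1 / 2) = 2 * \<bar>\<xi>1\<bar> / \<eta>1" by simp
  ultimately show "\<bar>t + a / (\<delta> * v1)\<bar> \<le> 2 * \<bar>\<xi>1\<bar> / \<eta>1 + \<bar>\<gamma> / \<delta>\<bar>"
    using abs_triangle_ineq4[of "\<xi>1 / v1" "\<gamma> / \<delta>"] by (simp add: mult.commute)
qed


section \<open>Lattice matrices with second row close to (\<eta>1, \<eta>2)\<close>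

text \<open>Scalar form of the conclusion, where L has rows \<open>(a, b)\<close> and
  \<open>(c, d)\<close>.\<close>

definition orbit_close :: "real \<Rightarrow> real \<Rightarrow> real \<Rightarrow> real \<Rightarrow>
    real \<Rightarrow> real \<Rightarrow> real \<Rightarrow> real \<Rightarrow> real \<Rightarrow> real \<Rightarrow> bool" where
  "orbit_close \<alpha> \<beta> \<gamma> \<delta> \<xi>1 \<xi>2 \<eta>1 \<eta>2 T e \<longleftrightarrow>
     (\<exists>(a::int) (b::int) (c::int) (d::int) t. a * d - b * c = (1::int) \<and> 1 \<le> \<bar>t\<bar> \<and> \<bar>t\<bar> \<le> T \<and>
        \<bar>\<alpha> * a + \<gamma> * c + t * (\<beta> * a + \<delta> * c) - \<xi>1\<bar> \<le> e \<and>
        \<bar>\<alpha> * b + \<gamma> * d + t * (\<beta> * b + \<delta> * d) - \<xi>2\<bar> \<le> e \<and>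
        \<bar>\<beta> * a + \<delta> * c - \<eta>1\<bar> \<le> e \<and> \<bar>\<beta> * b + \<delta> * d - \<eta>2\<bar> \<le> e)"

text \<open>L = M N with N from the scaled property. Writing E for \<open>k * Q powr r\<close>, the
  second-row error has order E / Q, while \<open>a\<close> is bounded on both sides by multiples of
  Q E; the two sides serve |t| \<ge> 1 and |t| \<le> T.\<close>

lemma lattice_second_row:
  fixes r \<beta> \<delta> \<eta>1 \<eta>2 k :: real
  assumes "approximation_property r" and r: "0 < r" "r < 1" and "\<delta> \<noteq> 0" "0 < \<eta>1" "0 < \<eta>2" "0 < k"
  shows "\<forall>\<^sub>F Q in at_top. \<forall>m11 m12 m21 m22 :: int.
     Q = \<bar>m12\<bar> \<longrightarrow> m11 * m22 - m12 * m21 = 1 \<longrightarrow> \<delta> * m12 < 0 \<longrightarrow>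
     1 \<le> real_of_int m11 / m12 \<longrightarrow> real_of_int m11 / m12 \<le> 2 \<longrightarrow>
     \<bar>\<beta> * m11 + \<delta> * m21\<bar> \<le> 5 * \<bar>\<delta>\<bar> / Q \<longrightarrow> \<bar>\<beta> * m12 + \<delta> * m22\<bar> \<le> 5 * \<bar>\<delta>\<bar> / Q \<longrightarrow>
     (\<exists>a b c d :: int. a * d - b * c = 1 \<and>
        3 * Q * (k * Q powr r) \<le> a \<and> a \<le> 9 * Q * (k * Q powr r) \<and>
        \<bar>\<beta> * a + \<delta> * c - \<eta>1\<bar> \<le> 40 * \<bar>\<delta>\<bar> * (1 + \<eta>2 / \<eta>1) * (k * Q powr r) / Q \<and>
        \<bar>\<beta> * b + \<delta> * d - \<eta>2\<bar> \<le> 40 * \<bar>\<delta>\<bar> * (1 + \<eta>2 / \<eta>1) * (k * Q powr r) / Q)"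
proof -
  \<comment> \<open>Holds because r < 1, and gives \<open>\<tau> \<le> Q / 2\<close>, so that the
    perturbed factor stays in [1/2, 5/2].\<close>
  have "\<forall>\<^sub>F Q in at_top. 12 * \<bar>\<delta>\<bar> * (k * Q powr r) \<le> \<eta>1 * Q"
    using assms by real_asymp
  moreover have "\<forall>\<^sub>F Q in at_top. \<forall>\<rho> A B. 1 / 2 \<le> \<rho> \<and> \<rho> \<le> 5 / 2 \<and>
        min \<eta>1 \<eta>2 / \<bar>\<delta>\<bar> * Q \<le> A \<and> A \<le> max \<eta>1 \<eta>2 / \<bar>\<delta>\<bar> * Q \<and>
        min \<eta>1 \<eta>2 / \<bar>\<delta>\<bar> * Q \<le> B \<and> B \<le> max \<eta>1 \<eta>2 / \<bar>\<delta>\<bar> * Q \<longrightarrow>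
        (\<exists>x y z w :: int. x * y - z * w = 1 \<and>
           \<bar>of_int x - A\<bar> \<le> k * Q powr r \<and> \<bar>of_int z - B\<bar> \<le> k * Q powr r \<and>
           \<bar>of_int w + \<rho> * A\<bar> \<le> k * Q powr r \<and> \<bar>of_int y + \<rho> * B\<bar> \<le> k * Q powr r)"
    using assms by (intro approximation_property_scaled) auto
  ultimately show ?thesis
  proof eventually_elim
    case (elim Q)
    show ?case
    proof (intro allI impI, goal_cases)
      case (1 m11 m12 m21 m22)
      define E where "E = k * Q powr r"
      \<comment> \<open>Chosen so that \<open>\<tau> * A = 6 * Q * E\<close>: the error of the
        first-row entry is at most 3 Q E, which leaves it between 3 Q E and 9 Q E.\<close>
      define \<tau> where "\<tau> = 6 * \<bar>\<delta>\<bar> * E / \<eta>1"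
      define \<rho> where "\<rho> = (m11 - \<tau>) / m12"
      define A B where "A = - (\<eta>1 * m12 / \<delta>)" and "B = - (\<eta>2 * m12 / \<delta>)"
      have Q: "Q > 0" "real_of_int m12 \<noteq> 0" using 1 by auto
      have E: "E > 0" using Q assms(7) by (simp add: E_def)
      have u: "real_of_int m12 / \<delta> = - (Q / \<bar>\<delta>\<bar>)"
        using 1(1,3) by (cases "\<delta> > 0") (auto simp: mult_less_0_iff)
      have AB: "A = \<eta>1 * Q / \<bar>\<delta>\<bar>" "B = \<eta>2 * Q / \<bar>\<delta>\<bar>"
        unfolding A_def B_def times_divide_eq_right[symmetric] u by simp_all
      have \<tau>: "0 \<le> \<tau>" "\<tau> \<le> Q / 2"
        using elim(1) E assms(5) by (auto simp: \<tau>_def E_def[symmetric] field_simps)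
      have "\<bar>\<tau> / m12\<bar> \<le> 1 / 2"
        using \<tau> Q 1(1) by (simp add: field_simps)
      moreover have "\<rho> = m11 / m12 - \<tau> / m12" by (simp add: \<rho>_def diff_divide_distrib)
      ultimately have \<rho>: "1 / 2 \<le> \<rho>" "\<rho> \<le> 5 / 2" using 1(4,5) by linarith+
      have "min \<eta>1 \<eta>2 / \<bar>\<delta>\<bar> * Q \<le> A" "A \<le> max \<eta>1 \<eta>2 / \<bar>\<delta>\<bar> * Q"
        "min \<eta>1 \<eta>2 / \<bar>\<delta>\<bar> * Q \<le> B" "B \<le> max \<eta>1 \<eta>2 / \<bar>\<delta>\<bar> * Q"
        unfolding AB times_divide_eq_left using Q
        by (auto intro!: divide_right_mono mult_right_mono)
      then obtain x y z w :: int where N: "x * y - z * w = 1"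
        and e: "\<bar>x - A\<bar> \<le> E" "\<bar>z - B\<bar> \<le> E" "\<bar>w + \<rho> * A\<bar> \<le> E" "\<bar>y + \<rho> * B\<bar> \<le> E"
        using elim(2) \<rho> unfolding E_def by blast
      have det: "real_of_int m11 * real_of_int m22 - real_of_int m12 * real_of_int m21 = 1"
        using 1(2) by (metis of_int_1 of_int_diff of_int_mult)
      note col1 = column_estimate[OF det assms(4) Q(2) A_def e(1) e(3)[unfolded \<rho>_def] 1(6,7)]
      note col2 = column_estimate[OF det assms(4) Q(2) B_def e(2) e(4)[unfolded \<rho>_def] 1(6,7)]
      show ?case
        unfolding E_def[symmetric]
      proof (intro exI conjI)
        show "(m11 * x + m12 * w) * (m21 * z + m22 * y) - (m11 * z + m12 * y) * (m21 * x + m22 * w) = 1"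
        proof -
          have "(m11 * x + m12 * w) * (m21 * z + m22 * y) - (m11 * z + m12 * y) * (m21 * x + m22 * w)
            = (m11 * m22 - m12 * m21) * (x * y - z * w)" by (simp add: algebra_simps)
          then show ?thesis using N 1(2) by simp
        qed
        have "\<bar>real_of_int m11\<bar> = m11 / m12 * Q"
          using 1(1,4) Q by (cases "m12 > 0") (auto simp: field_simps)
        also have "\<dots> \<le> 2 * Q" using 1(5) Q by (intro mult_right_mono) auto
        finally have "(\<bar>real_of_int m11\<bar> + \<bar>real_of_int m12\<bar>) * E \<le> (3 * Q) * E"
          using 1(1) E by (intro mult_right_mono) auto
        moreover have "\<tau> * A = 6 * Q * E"
          using assms(4,5) by (simp add: \<tau>_def AB)
        ultimately show "3 * Q * E \<le> real_of_int (m11 * x + m12 * w)"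
          "real_of_int (m11 * x + m12 * w) \<le> 9 * Q * E"
          using col1(2) by auto
        \<comment> \<open>Of the coefficient, 10 comes from \<open>E\<close> and 30 from \<tau>; the
          bound in \<open>g\<close> covers both \<eta> = \<eta>1 and \<eta> = \<eta>2.\<close>
        have h: "5 * \<bar>\<delta>\<bar> / Q * (2 * E + \<bar>\<tau>\<bar> * \<bar>\<eta>\<bar> / \<bar>\<delta>\<bar>) = (10 + 30 * (\<eta> / \<eta>1)) * (\<bar>\<delta>\<bar> * E / Q)"
          if "\<eta> > 0" for \<eta>
          using assms(4,5) \<tau>(1) Q that by (simp add: \<tau>_def field_simps)
        have g: "40 * \<bar>\<delta>\<bar> * (1 + \<eta>2 / \<eta>1) * E / Q = (40 + 40 * (\<eta>2 / \<eta>1)) * (\<bar>\<delta>\<bar> * E / Q)"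
          by (simp add: field_simps)
        have pos: "0 \<le> \<bar>\<delta>\<bar> * E / Q" "0 \<le> \<eta>2 / \<eta>1" using E Q assms(5,6) by auto
        have "5 * \<bar>\<delta>\<bar> / Q * (2 * E + \<bar>\<tau>\<bar> * \<bar>\<eta>1\<bar> / \<bar>\<delta>\<bar>) \<le> 40 * \<bar>\<delta>\<bar> * (1 + \<eta>2 / \<eta>1) * E / Q"
          unfolding h[OF assms(5)] g using pos assms(5) by (intro mult_right_mono) auto
        then show "\<bar>\<beta> * real_of_int (m11 * x + m12 * w) + \<delta> * real_of_int (m21 * x + m22 * w) - \<eta>1\<bar>
            \<le> 40 * \<bar>\<delta>\<bar> * (1 + \<eta>2 / \<eta>1) * E / Q"
          using col1(1) by simp
        have "5 * \<bar>\<delta>\<bar> / Q * (2 * E + \<bar>\<tau>\<bar> * \<bar>\<eta>2\<bar> / \<bar>\<delta>\<bar>) \<le> 40 * \<bar>\<delta>\<bar> * (1 + \<eta>2 / \<eta>1) * E / Q"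
          unfolding h[OF assms(6)] g using pos by (intro mult_right_mono) linarith+
        then show "\<bar>\<beta> * real_of_int (m11 * z + m12 * y) + \<delta> * real_of_int (m21 * z + m22 * y) - \<eta>2\<bar>
            \<le> 40 * \<bar>\<delta>\<bar> * (1 + \<eta>2 / \<eta>1) * E / Q"
          using col2(1) by simp
      qed
    qed
  qed
qed

section \<open>Reduction to positive \<eta>1 and \<eta>2\<close>

text \<open>The shear acts on the left, so a matrix L good for the target times K yields L K^(-1)
  for the target with the same \<open>t\<close>. The entries of K^(-1) are those of K up to sign and
  position, whence the factor in the error.\<close>

lemma orbit_close_right_mult:
  fixes k11 k12 k21 k22 :: int and \<alpha> \<beta> \<gamma> \<delta> \<xi>1 \<xi>2 \<eta>1 \<eta>2 T e :: real
  assumes "orbit_close \<alpha> \<beta> \<gamma> \<delta> (\<xi>1 * k11 + \<xi>2 * k21) (\<xi>1 * k12 + \<xi>2 * k22)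
             (\<eta>1 * k11 + \<eta>2 * k21) (\<eta>1 * k12 + \<eta>2 * k22) T e"
    and det: "k11 * k22 - k12 * k21 = 1"
  shows "orbit_close \<alpha> \<beta> \<gamma> \<delta> \<xi>1 \<xi>2 \<eta>1 \<eta>2 T ((\<bar>k11\<bar> + \<bar>k12\<bar> + \<bar>k21\<bar> + \<bar>k22\<bar>) * e)"
proof -
  from assms(1) obtain a b c d :: int and t where L: "a * d - b * c = 1" and t: "1 \<le> \<bar>t\<bar>" "\<bar>t\<bar> \<le> T"
    and e: "\<bar>\<alpha> * a + \<gamma> * c + t * (\<beta> * a + \<delta> * c) - (\<xi>1 * k11 + \<xi>2 * k21)\<bar> \<le> e"
      "\<bar>\<alpha> * b + \<gamma> * d + t * (\<beta> * b + \<delta> * d) - (\<xi>1 * k12 + \<xi>2 * k22)\<bar> \<le> e"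
      "\<bar>\<beta> * a + \<delta> * c - (\<eta>1 * k11 + \<eta>2 * k21)\<bar> \<le> e"
      "\<bar>\<beta> * b + \<delta> * d - (\<eta>1 * k12 + \<eta>2 * k22)\<bar> \<le> e"
    unfolding orbit_close_def by blast
  have det': "real_of_int k11 * real_of_int k22 - real_of_int k12 * real_of_int k21 = 1"
    using det by (metis of_int_1 of_int_diff of_int_mult)
  have comb: "\<bar>u * real_of_int m + v * real_of_int n\<bar> \<le> (\<bar>k11\<bar> + \<bar>k12\<bar> + \<bar>k21\<bar> + \<bar>k22\<bar>) * e"
    if "\<bar>u\<bar> \<le> e" "\<bar>v\<bar> \<le> e" "\<bar>m\<bar> + \<bar>n\<bar> \<le> \<bar>k11\<bar> + \<bar>k12\<bar> + \<bar>k21\<bar> + \<bar>k22\<bar>" for u v m n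
  proof -
    have "\<bar>u * real_of_int m\<bar> \<le> e * \<bar>m\<bar>" "\<bar>v * real_of_int n\<bar> \<le> e * \<bar>n\<bar>"
      unfolding abs_mult of_int_abs using that by (auto intro: mult_right_mono)
    moreover have "(\<bar>m\<bar> + \<bar>n\<bar>) * e \<le> (\<bar>k11\<bar> + \<bar>k12\<bar> + \<bar>k21\<bar> + \<bar>k22\<bar>) * e"
      using that by (intro mult_right_mono) linarith+
    ultimately show ?thesis
      using abs_triangle_ineq[of "u * real_of_int m" "v * real_of_int n"]
      by (simp add: algebra_simps)
  qed
  let ?a = "a * k22 - b * k21" and ?b = "b * k11 - a * k12"
  let ?c = "c * k22 - d * k21" and ?d = "d * k11 - c * k12"
  \<comment> \<open>For any row (p, q), the error of (p, q) L K^(-1) against (x, y) is that of (p,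
    q) L against (x, y) K, times K^(-1). Both rows of the product are treated this way.\<close>
  have left: "p * ?a + q * ?c - x = (p * a + q * c - (x * k11 + y * k21)) * k22
                 + (p * b + q * d - (x * k12 + y * k22)) * real_of_int (- k21)"
    and right: "p * ?b + q * ?d - y = (p * a + q * c - (x * k11 + y * k21)) * real_of_int (- k12)
                 + (p * b + q * d - (x * k12 + y * k22)) * k11" for p q x y :: real
  proof -
    have "p * ?a + q * ?c - x * (real_of_int k11 * real_of_int k22 - real_of_int k12 * real_of_int k21)
      = (p * a + q * c - (x * k11 + y * k21)) * k22
                 + (p * b + q * d - (x * k12 + y * k22)) * real_of_int (- k21)"
      by (simp add: algebra_simps)
    then show "p * ?a + q * ?c - x = (p * a + q * c - (x * k11 + y * k21)) * k22
                 + (p * b + q * d - (x * k12 + y * k22)) * real_of_int (- k21)"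
      using det' by simp
    have "p * ?b + q * ?d - y * (real_of_int k11 * real_of_int k22 - real_of_int k12 * real_of_int k21)
      = (p * a + q * c - (x * k11 + y * k21)) * real_of_int (- k12)
                 + (p * b + q * d - (x * k12 + y * k22)) * k11"
      by (simp add: algebra_simps)
    then show "p * ?b + q * ?d - y = (p * a + q * c - (x * k11 + y * k21)) * real_of_int (- k12)
                 + (p * b + q * d - (x * k12 + y * k22)) * k11"
      using det' by simp
  qed
  have factor: "\<alpha> * m + \<gamma> * n + t * (\<beta> * m + \<delta> * n) = (\<alpha> + t * \<beta>) * m + (\<gamma> + t * \<delta>) * n" for m n :: real
    by (simp add: algebra_simps)
  have "?a * ?d - ?b * ?c = (a * d - b * c) * (k11 * k22 - k12 * k21)"
    by (simp add: algebra_simps)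
  then have unimodular: "?a * ?d - ?b * ?c = 1" using L det by simp
  show ?thesis
    unfolding orbit_close_def
  proof (rule exI[of _ ?a], rule exI[of _ ?b], rule exI[of _ ?c], rule exI[of _ ?d],
      rule exI[of _ t], intro conjI t unimodular)
    show "\<bar>\<alpha> * ?a + \<gamma> * ?c + t * (\<beta> * ?a + \<delta> * ?c) - \<xi>1\<bar> \<le> (\<bar>k11\<bar> + \<bar>k12\<bar> + \<bar>k21\<bar> + \<bar>k22\<bar>) * e"
      unfolding factor left[of _ _ \<xi>1 \<xi>2] using e(1,2) unfolding factor by (intro comb) auto
    show "\<bar>\<alpha> * ?b + \<gamma> * ?d + t * (\<beta> * ?b + \<delta> * ?d) - \<xi>2\<bar> \<le> (\<bar>k11\<bar> + \<bar>k12\<bar> + \<bar>k21\<bar> + \<bar>k22\<bar>) * e"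
      unfolding factor right[of _ _ \<xi>2 \<xi>1] using e(1,2) unfolding factor by (intro comb) auto
    show "\<bar>\<beta> * ?a + \<delta> * ?c - \<eta>1\<bar> \<le> (\<bar>k11\<bar> + \<bar>k12\<bar> + \<bar>k21\<bar> + \<bar>k22\<bar>) * e"
      unfolding left[of _ _ \<eta>1 \<eta>2] using e(3,4) by (intro comb) auto
    show "\<bar>\<beta> * ?b + \<delta> * ?d - \<eta>2\<bar> \<le> (\<bar>k11\<bar> + \<bar>k12\<bar> + \<bar>k21\<bar> + \<bar>k22\<bar>) * e"
      unfolding right[of _ _ \<eta>2 \<eta>1] using e(3,4) by (intro comb) auto
  qed
qed

text \<open>A sign makes a nonzero entry positive; adding a sufficiently large multiple of its
  column to the other column makes that one positive as well.\<close>

lemma unimodular_positive_row: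
  fixes \<eta>1 \<eta>2 :: real
  assumes "\<eta>1 \<noteq> 0 \<or> \<eta>2 \<noteq> 0"
  obtains k11 k12 k21 k22 :: int where "k11 * k22 - k12 * k21 = 1"
    "0 < \<eta>1 * k11 + \<eta>2 * k21" "0 < \<eta>1 * k12 + \<eta>2 * k22"
proof (cases "\<eta>1 = 0")
  case True
  define s :: int where "s = (if \<eta>2 > 0 then 1 else -1)"
  have "s * s = 1" "\<eta>2 * s > 0" using assms True by (auto simp: s_def)
  then show thesis using True by (intro that[of 0 s "- s" s]) auto
next
  case False
  define s :: int where "s = (if \<eta>1 > 0 then 1 else -1)"
  have s: "s * s = 1" "\<eta>1 * s = \<bar>\<eta>1\<bar>" "\<bar>\<eta>2 * s\<bar> = \<bar>\<eta>2\<bar>" using False by (auto simp: s_def)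
  define m where "m = \<lceil>\<bar>\<eta>2\<bar> / \<bar>\<eta>1\<bar>\<rceil> + 1"
  have "\<bar>\<eta>2\<bar> / \<bar>\<eta>1\<bar> < m" unfolding m_def by linarith
  then have "\<bar>\<eta>2\<bar> < \<bar>\<eta>1\<bar> * m" using False by (simp add: field_simps)
  moreover have "\<eta>1 * (s * m) + \<eta>2 * s = \<bar>\<eta>1\<bar> * m + \<eta>2 * s"
    by (simp flip: s(2) add: algebra_simps)
  ultimately have "0 < \<eta>1 * (s * m) + \<eta>2 * s" using s(3) by linarith
  then show thesis using s False by (intro that[of s s "s * m" 0]) (auto simp: algebra_simps)
qed

section \<open>Choice of the constants and the bounds on t\<close>

text \<open>\<open>\<rho>_le\<close> carries the Diophantine information on \<beta> / \<delta>. In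
  the second-row error E / Q, the bound Q \<le> 2 X is used in E and Q \<ge> \<rho> X in the
  denominator, giving O(X^r / \<rho> X).\<close>

lemma orbit_close_positive:
  fixes r \<alpha> \<beta> \<gamma> \<delta> \<xi>1 \<xi>2 \<eta>1 \<eta>2 :: real and \<rho> :: "real \<Rightarrow> real"
  assumes ap: "approximation_property r" and r: "0 < r" "r < 1"
    and g: "\<alpha> * \<delta> - \<gamma> * \<beta> = 1" and Xi: "\<xi>1 * \<eta>2 - \<xi>2 * \<eta>1 = 1"
    and \<delta>: "\<delta> \<noteq> 0" and \<eta>: "0 < \<eta>1" "0 < \<eta>2"
    and \<rho>_pos: "\<And>X. X \<ge> 1 \<Longrightarrow> \<rho> X > 0"
    and \<rho>_le: "\<And>X (q::int) (p::int). X \<ge> 1 \<Longrightarrow> q \<ge> (1::int) \<Longrightarrow> \<bar>\<beta> / \<delta> * q - p\<bar> < 1 / X \<Longrightarrow> \<rho> X \<le> q"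
  shows "\<exists>C>0. \<forall>T\<ge>1. orbit_close \<alpha> \<beta> \<gamma> \<delta> \<xi>1 \<xi>2 \<eta>1 \<eta>2 T
           (C * (T powr (r / (1 + r)) / \<rho> (T powr (1 / (1 + r)))))"
proof -
  \<comment> \<open>The 200 brings the main term of |t| down to 72/200 T, leaving room for D \<le>
    T/2.\<close>
  define k where "k = \<bar>\<delta>\<bar> * \<eta>1 / 200"
  have k: "k > 0" using \<delta> \<eta> by (simp add: k_def)
  define D where "D = 2 * \<bar>\<xi>1\<bar> / \<eta>1 + \<bar>\<gamma> / \<delta>\<bar>"
  have D: "D \<ge> 0" using \<eta> by (simp add: D_def)
  have "filterlim (\<lambda>Q. 2 * Q * (k * Q powr r)) at_top at_top"
    using k r by real_asymp
  then have ev: "\<forall>\<^sub>F Q in at_top. (1 + D) * \<bar>\<delta>\<bar> * \<eta>1 \<le> 2 * Q * (k * Q powr r)"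
    by (simp add: filterlim_at_top)
  \<comment> \<open>From \<open>Q0\<close> on, \<open>ev\<close> yields |t| \<ge> 1 and the bound by
    4 D yields D \<le> T/2.\<close>
  from eventually_conj[OF lattice_second_row[OF ap r \<delta> \<eta> k, of \<beta>]
      eventually_conj[OF ev eventually_ge_at_top[of "max 1 (4 * D)"]]]
  show ?thesis
    unfolding eventually_at_top_linorder
  proof (elim exE, goal_cases)
    case (1 Q0)
    then have Q0: "Q0 \<ge> 1" "Q0 \<ge> 4 * D"
      and big: "\<And>Q. Q \<ge> Q0 \<Longrightarrow> (1 + D) * \<bar>\<delta>\<bar> * \<eta>1 \<le> 2 * Q * (k * Q powr r)"
      by auto
    note row = 1[rule_format, THEN conjunct1, rule_format]
    \<comment> \<open>The 80 is the 40 of \<open>lattice_second_row\<close> times the 2 in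
      \<open>E_le\<close>.\<close>
    define C0 where "C0 = 80 * \<bar>\<delta>\<bar> * k * (1 + \<eta>2 / \<eta>1)"
    have C0: "C0 > 0" using \<delta> k \<eta> by (simp add: C0_def add_pos_pos)
    \<comment> \<open>Threshold for \<open>e\<close>: below 1 / Q0 it forces Q \<ge> Q0, and below
      the other value the second-row error is at most \<eta>1 / 2, as \<open>shear_estimate\<close>
      demands.\<close>
    define c0 where "c0 = min (1 / Q0) (\<eta>1 / (2 * C0))"
    have c0: "c0 > 0" using Q0 C0 \<eta> by (simp add: c0_def)
    \<comment> \<open>Bounds the errors of L = 1, t = 1, the choice that suffices once
      \<open>e\<close> reaches \<open>c0\<close>.\<close>
    define D1 where "D1 = \<bar>\<alpha> + \<beta> - \<xi>1\<bar> + \<bar>\<gamma> + \<delta> - \<xi>2\<bar> + \<bar>\<beta> - \<eta>1\<bar> + \<bar>\<delta> - \<eta>2\<bar>"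
    define F where "F = 2 * (\<bar>\<xi>1\<bar> + \<bar>\<xi>2\<bar>) / \<eta>1"
    have F: "F \<ge> 0" using \<eta> by (simp add: F_def)
    define C where "C = D1 / c0 + C0 * (1 + F)"
    have C: "C > 0" "D1 / c0 \<le> C" "C0 \<le> C" "F * C0 \<le> C"
      using C0 F c0 by (auto simp: C_def D1_def algebra_simps intro!: add_nonneg_pos add_pos_nonneg)
    have "orbit_close \<alpha> \<beta> \<gamma> \<delta> \<xi>1 \<xi>2 \<eta>1 \<eta>2 T
             (C * (T powr (r / (1 + r)) / \<rho> (T powr (1 / (1 + r)))))" if T: "T \<ge> 1" for T
    proof -
      define X where "X = T powr (1 / (1 + r))"
      define e where "e = X powr r / \<rho> X"
      have X: "X \<ge> 1" using T r by (simp add: X_def ge_one_powr_ge_zero)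
      have TX: "X powr (1 + r) = T" "X powr r = T powr (r / (1 + r))"
        using T r by (simp_all add: X_def powr_powr)
      have e: "e > 0" using X \<rho>_pos[OF X] by (simp add: e_def)
      have "orbit_close \<alpha> \<beta> \<gamma> \<delta> \<xi>1 \<xi>2 \<eta>1 \<eta>2 T (C * e)"
      proof (cases "c0 \<le> e")
        case True
        have "D1 = D1 / c0 * c0" using c0 by simp
        also have "\<dots> \<le> C * e" using C True c0 by (intro mult_mono) auto
        finally have "D1 \<le> C * e" .
        then show ?thesis
          unfolding orbit_close_def D1_def using T
          by (intro exI[of _ 1] exI[of _ 0]) (auto simp: algebra_simps)
      next
        case False
        obtain m11 m12 m21 m22 p :: int where M: "m11 * m22 - m12 * m21 = 1" "\<delta> * m12 < 0"
          "1 \<le> real_of_int m11 / m12" "real_of_int m11 / m12 \<le> 2" "\<bar>m12\<bar> \<le> 2 * X"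
          and p: "\<bar>\<beta> / \<delta> * of_int \<bar>m12\<bar> - of_int p\<bar> < 1 / X"
          and h: "\<bar>\<beta> * m11 + \<delta> * m21\<bar> \<le> 5 * \<bar>\<delta>\<bar> / \<bar>m12\<bar>" "\<bar>\<beta> * m12 + \<delta> * m22\<bar> \<le> 5 * \<bar>\<delta>\<bar> / \<bar>m12\<bar>"
          using unimodular_approximation[OF \<delta> X, of \<beta>] by metis
        define Q where "Q = real_of_int \<bar>m12\<bar>"
        have "m12 \<noteq> 0" using M(2) by auto
        then have "\<bar>m12\<bar> \<ge> 1" by linarith
        then have \<rho>Q: "\<rho> X \<le> Q" unfolding Q_def using \<rho>_le[OF X _ p] by simp
        \<comment> \<open>A small \<open>e\<close> makes \<open>\<rho> X\<close>, and with it
          \<open>Q\<close>, large enough for \<open>lattice_second_row\<close>.\<close>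
        have "1 \<le> X powr r" using X r by (simp add: ge_one_powr_ge_zero)
        also have "\<dots> < c0 * \<rho> X" using False \<rho>_pos[OF X] by (simp add: e_def field_simps)
        also have "\<dots> \<le> 1 / Q0 * Q" using \<rho>Q \<rho>_pos[OF X] Q0 by (intro mult_mono) (auto simp: c0_def)
        finally have Q: "Q \<ge> Q0" using Q0 by (simp add: field_simps)
        then have Q_pos: "Q \<ge> 1" "Q > 0" using Q0 by auto
        define E where "E = k * Q powr r"
        have E: "E > 0" using k Q_pos by (simp add: E_def)
        obtain a b c d :: int where L: "a * d - b * c = 1" and a: "3 * Q * E \<le> a" "a \<le> 9 * Q * E"
          and v: "\<bar>\<beta> * a + \<delta> * c - \<eta>1\<bar> \<le> 40 * \<bar>\<delta>\<bar> * (1 + \<eta>2 / \<eta>1) * E / Q"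
            "\<bar>\<beta> * b + \<delta> * d - \<eta>2\<bar> \<le> 40 * \<bar>\<delta>\<bar> * (1 + \<eta>2 / \<eta>1) * E / Q"
          using row[OF Q Q_def M(1-4) h[folded Q_def]] unfolding E_def by blast
        have E_le: "E \<le> 2 * k * X powr r"
        proof -
          have "Q powr r \<le> (2 * X) powr r"
            using M(5) Q_pos r by (intro powr_mono2) (auto simp: Q_def)
          also have "\<dots> = 2 powr r * X powr r" using X by (simp add: powr_mult)
          also have "\<dots> \<le> 2 powr 1 * X powr r" using r by (intro mult_right_mono powr_mono) auto
          finally show ?thesis using k by (simp add: E_def mult_left_mono)
        qed
        have "E / Q \<le> 2 * k * X powr r / \<rho> X"
          using E_le E \<rho>Q \<rho>_pos[OF X] by (intro frac_le) auto
        then have "40 * \<bar>\<delta>\<bar> * (1 + \<eta>2 / \<eta>1) * (E / Q) \<le> 40 * \<bar>\<delta>\<bar> * (1 + \<eta>2 / \<eta>1) * (2 * k * X powr r / \<rho> X)"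
          using \<eta> by (intro mult_left_mono) auto
        also have "\<dots> = C0 * e" by (simp add: C0_def e_def)
        finally have \<epsilon>: "40 * \<bar>\<delta>\<bar> * (1 + \<eta>2 / \<eta>1) * E / Q \<le> C0 * e" by simp
        have "C0 * e \<le> C0 * (\<eta>1 / (2 * C0))"
          using False C0 by (intro mult_left_mono) (auto simp: c0_def)
        then have small: "C0 * e \<le> \<eta>1 / 2" using C0 by simp
        have L': "real_of_int a * real_of_int d - real_of_int b * real_of_int c = 1"
          using L by (metis of_int_1 of_int_diff of_int_mult)
        define v1 where "v1 = \<beta> * a + \<delta> * c"
        define t where "t = (\<xi>1 - (\<alpha> * a + \<gamma> * c)) / v1"
        note v' = order_trans[OF v(1) \<epsilon>] order_trans[OF v(2) \<epsilon>]
        note shear = shear_estimate[OF g L' Xi \<delta> \<eta>(1) v' small]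
        note shear' = shear[folded v1_def, folded t_def]
        have v1: "\<eta>1 / 2 \<le> v1" "v1 \<le> 3 * \<eta>1 / 2" "v1 > 0"
          using v'(1) small \<eta> unfolding v1_def by linarith+
        have QE: "Q * E > 0" using E Q_pos by simp
        have s: "\<bar>a / (\<delta> * v1)\<bar> = a / (\<bar>\<delta>\<bar> * v1)"
          using v1 a(1) QE by (simp add: abs_mult)
        \<comment> \<open>The main term of |t| must exceed 1 by \<open>D\<close>, the possible loss
          in \<open>shear_estimate\<close>.\<close>
        have "1 + D \<le> 2 * Q * E / (\<bar>\<delta>\<bar> * \<eta>1)"
          using big[OF Q] \<delta> \<eta> by (simp add: E_def field_simps)
        also have "\<dots> = 3 * Q * E / (\<bar>\<delta>\<bar> * (3 * \<eta>1 / 2))"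
          using \<delta> \<eta> by (simp add: field_simps)
        also have "\<dots> \<le> a / (\<bar>\<delta>\<bar> * v1)"
          using a(1) v1 QE \<delta> by (intro frac_le mult_left_mono) auto
        finally have t1: "1 \<le> \<bar>t\<bar>" using shear'(3) s unfolding D_def by linarith
        \<comment> \<open>The exponent in \<open>X\<close> is chosen for this product: X * X^r =
          T.\<close>
        have "Q * E \<le> 2 * X * (2 * k * X powr r)"
          using M(5) E_le E X by (intro mult_mono) (auto simp: Q_def)
        also have "\<dots> = 4 * k * T" using X by (simp flip: TX(1) add: powr_add)
        finally have "a \<le> 36 * k * T" using a(2) by linarith
        then have "a / (\<bar>\<delta>\<bar> * v1) \<le> 36 * k * T / (\<bar>\<delta>\<bar> * (\<eta>1 / 2))"
          using v1 \<delta> \<eta> k T by (intro frac_le mult_left_mono) auto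
        also have "\<dots> = 72 / 200 * T" using \<delta> \<eta> by (simp add: k_def)
        finally have up: "a / (\<bar>\<delta>\<bar> * v1) \<le> 72 / 200 * T" .
        have "X powr 1 \<le> X powr (1 + r)" using X r by (intro powr_mono) auto
        then have "X \<le> T" using X TX by simp
        \<comment> \<open>Chains 4 D \<le> Q0 \<le> Q \<le> 2 X \<le> 2 T.\<close>
        then have "2 * D \<le> T" using M(5) Q Q0(2) unfolding Q_def by linarith
        then have t2: "\<bar>t\<bar> \<le> T" using shear'(3) s up T unfolding D_def[symmetric] by linarith
        have C': "C0 * e \<le> C * e" "F * (C0 * e) \<le> C * e"
          using C e by (simp_all flip: mult.assoc)
        show ?thesis
          unfolding orbit_close_def
        proof (rule exI[of _ a], rule exI[of _ b], rule exI[of _ c], rule exI[of _ d],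
            rule exI[of _ t], intro conjI L t1 t2)
          show "\<bar>\<alpha> * a + \<gamma> * c + t * (\<beta> * a + \<delta> * c) - \<xi>1\<bar> \<le> C * e"
            using shear'(1) C(1) e unfolding v1_def by simp
          show "\<bar>\<alpha> * b + \<gamma> * d + t * (\<beta> * b + \<delta> * d) - \<xi>2\<bar> \<le> C * e"
            using order_trans[OF shear'(2)[folded F_def] C'(2)] .
          show "\<bar>\<beta> * a + \<delta> * c - \<eta>1\<bar> \<le> C * e" "\<bar>\<beta> * b + \<delta> * d - \<eta>2\<bar> \<le> C * e"
            using order_trans[OF v'(1) C'(1)] order_trans[OF v'(2) C'(1)] .
        qed
      qed
      then show ?thesis by (simp only: e_def TX(2) X_def[symmetric])
    qed
    with C(1) show ?thesis by blast
  qed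
qed

section \<open>Passage from scalars to matrices\<close>

lemma max_norm_mat2: "max_norm (mat2 a b c d) = Max {\<bar>a\<bar>, \<bar>b\<bar>, \<bar>c\<bar>, \<bar>d\<bar>}"
proof -
  have ex: "(\<exists>i::2. P i) \<longleftrightarrow> P 1 \<or> P 2" for P by (metis exhaust_2)
  have "{\<bar>mat2 a b c d $ i $ j\<bar> | i j. True} = {\<bar>a\<bar>, \<bar>b\<bar>, \<bar>c\<bar>, \<bar>d\<bar>}"
    unfolding mat2_def by (auto simp: ex)
  then show ?thesis by (simp only: max_norm_def)
qed

lemma det_mat2: "det (mat2 a b c d :: 'a::comm_ring_1^2^2) = a * d - b * c"
  by (simp add: det_2 mat2_def)

lemma mat2_eqI:
  "A $ 1 $ 1 = a \<Longrightarrow> A $ 1 $ 2 = b \<Longrightarrow> A $ 2 $ 1 = c \<Longrightarrow> A $ 2 $ 2 = d \<Longrightarrow> A = mat2 a b c d"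
  by (simp add: vec_eq_iff forall_2 mat2_def)

lemma orbit_close_imp_max_norm:
  assumes "orbit_close \<alpha> \<beta> \<gamma> \<delta> \<xi>1 \<xi>2 \<eta>1 \<eta>2 T e"
  shows "\<exists>(L :: int^2^2) (t :: real). det L = 1 \<and> 1 \<le> \<bar>t\<bar> \<and> \<bar>t\<bar> \<le> T \<and>
           max_norm (mat2 1 t 0 1 ** mat2 \<alpha> \<gamma> \<beta> \<delta> ** map_matrix real_of_int L
                      - mat2 \<xi>1 \<xi>2 \<eta>1 \<eta>2) \<le> e"
proof -
  from assms obtain a b c d :: int and t where L: "a * d - b * c = 1" and t: "1 \<le> \<bar>t\<bar>" "\<bar>t\<bar> \<le> T"
    and e: "\<bar>\<alpha> * a + \<gamma> * c + t * (\<beta> * a + \<delta> * c) - \<xi>1\<bar> \<le> e"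
      "\<bar>\<alpha> * b + \<gamma> * d + t * (\<beta> * b + \<delta> * d) - \<xi>2\<bar> \<le> e"
      "\<bar>\<beta> * a + \<delta> * c - \<eta>1\<bar> \<le> e" "\<bar>\<beta> * b + \<delta> * d - \<eta>2\<bar> \<le> e"
    unfolding orbit_close_def by blast
  have "mat2 1 t 0 1 ** mat2 \<alpha> \<gamma> \<beta> \<delta> ** map_matrix real_of_int (mat2 a b c d) - mat2 \<xi>1 \<xi>2 \<eta>1 \<eta>2
    = mat2 (\<alpha> * a + \<gamma> * c + t * (\<beta> * a + \<delta> * c) - \<xi>1) (\<alpha> * b + \<gamma> * d + t * (\<beta> * b + \<delta> * d) - \<xi>2)
        (\<beta> * a + \<delta> * c - \<eta>1) (\<beta> * b + \<delta> * d - \<eta>2)"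
    by (rule mat2_eqI) (simp_all add: matrix_matrix_mult_def sum_2 mat2_def map_matrix_def algebra_simps)
  then show ?thesis
    using e t L by (intro exI[of _ "mat2 a b c d"] exI[of _ t]) (simp add: max_norm_mat2 det_mat2)
qed

section \<open>The lower bound \<psi> and the theorem\<close>

text \<open>The lower bound gives X \<le> 1 / \<psi> q, and the monotone \<rho> sends the right side
  to q. Monotonicity also handles those X that 1 / \<psi> does not attain.\<close>

lemma reciprocal_inverse_le_denominator:
  fixes q p :: int and X \<theta> :: real and \<psi> \<rho> :: "real \<Rightarrow> real"
  assumes anti: "strict_antimono_on {1..} \<psi>" and lim: "(\<psi> \<longlongrightarrow> 0) at_top"
    and inv: "reciprocal_inverse \<psi> \<rho>"
    and low: "\<And>q :: nat. q \<ge> 1 \<Longrightarrow> (INF p :: int. \<bar>\<theta> * real q - of_int p\<bar>) \<ge> \<psi> (real q)"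
    and "X \<ge> 1" and "q \<ge> (1::int)" and close: "\<bar>\<theta> * real_of_int q - of_int p\<bar> < 1 / X"
  shows "\<rho> X \<le> q"
proof -
  have less: "\<psi> v < \<psi> u" if "1 \<le> u" "u < v" for u v
    using anti that by (auto simp: monotone_on_def)
  have nonneg: "0 \<le> \<psi> u" if "1 \<le> u" for u
  proof (rule tendsto_upperbound[OF lim])
    show "\<forall>\<^sub>F x in at_top. \<psi> x \<le> \<psi> u"
      using eventually_gt_at_top[of u] by eventually_elim (use less that in force)
  qed simp
  have q: "real_of_int q = real (nat q)" "nat q \<ge> 1" using assms(6) by auto
  \<comment> \<open>The limit 0 alone gives only nonnegative values; strict decrease from q to q + 1
    makes \<psi> q positive.\<close>
  have pos: "0 < \<psi> q" using less[of q "q + 1"] nonneg[of "q + 1"] assms(6) by simp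
  have "\<psi> q \<le> (INF p :: int. \<bar>\<theta> * real (nat q) - of_int p\<bar>)" by (subst q(1)) (rule low[OF q(2)])
  also have "\<dots> \<le> \<bar>\<theta> * real (nat q) - of_int p\<bar>"
    by (rule cINF_lower) (auto intro!: bdd_belowI[of _ 0])
  finally have "\<psi> q \<le> 1 / X" using close unfolding q(1) by linarith
  then have "X \<le> 1 / \<psi> q" using pos assms(5) by (simp add: field_simps)
  then have "\<rho> X \<le> \<rho> (1 / \<psi> q)"
    using inv assms(5) unfolding reciprocal_inverse_def mono_on_def by auto
  also have "\<dots> = q" using inv assms(6) unfolding reciprocal_inverse_def by simp
  finally show ?thesis .
qed

theorem theorem2:
  fixes r \<alpha> \<beta> \<gamma> \<delta> \<xi>\<^sub>1 \<xi>\<^sub>2 \<eta>\<^sub>1 \<eta>\<^sub>2 :: real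
    and \<psi> \<rho> :: "real \<Rightarrow> real"
  assumes "0 < r" and "r < 1" and "approximation_property r"
    and "det (mat2 \<alpha> \<gamma> \<beta> \<delta>) = 1"
    and "det (mat2 \<xi>\<^sub>1 \<xi>\<^sub>2 \<eta>\<^sub>1 \<eta>\<^sub>2) = 1"
    and "\<delta> \<noteq> 0" and "\<beta> / \<delta> \<notin> \<rat>"
    and "strict_antimono_on {1..} \<psi>"
    and "(\<psi> \<longlongrightarrow> 0) at_top"
    and "\<psi> \<in> O[at_top](\<lambda>t. 1 / t)"
    and "reciprocal_inverse \<psi> \<rho>"
    and "\<And>q :: nat. q \<ge> 1 \<Longrightarrow> (INF p :: int. \<bar>\<beta> / \<delta> * real q - of_int p\<bar>) \<ge> \<psi> (real q)"
  shows "\<exists>C>0. \<forall>T\<ge>1. \<exists>(L :: int^2^2) (t :: real). det L = 1 \<and> 1 \<le> \<bar>t\<bar> \<and> \<bar>t\<bar> \<le> T \<and>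
           max_norm (mat2 1 t 0 1 ** mat2 \<alpha> \<gamma> \<beta> \<delta> ** map_matrix real_of_int L
                      - mat2 \<xi>\<^sub>1 \<xi>\<^sub>2 \<eta>\<^sub>1 \<eta>\<^sub>2)
             \<le> C * T powr (r / (1 + r)) / \<rho> (T powr (1 / (1 + r)))"
proof -
  have g: "\<alpha> * \<delta> - \<gamma> * \<beta> = 1" and Xi: "\<xi>\<^sub>1 * \<eta>\<^sub>2 - \<xi>\<^sub>2 * \<eta>\<^sub>1 = 1"
    using assms(4,5) by (simp_all add: det_mat2)
  have "\<eta>\<^sub>1 \<noteq> 0 \<or> \<eta>\<^sub>2 \<noteq> 0" using Xi by auto
  then obtain k11 k12 k21 k22 :: int where K: "k11 * k22 - k12 * k21 = 1"
    and pos: "0 < \<eta>\<^sub>1 * k11 + \<eta>\<^sub>2 * k21" "0 < \<eta>\<^sub>1 * k12 + \<eta>\<^sub>2 * k22"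
    by (rule unimodular_positive_row)
  \<comment> \<open>The target times K keeps determinant 1, so \<open>orbit_close_positive\<close>
    applies to it.\<close>
  have "(\<xi>\<^sub>1 * k11 + \<xi>\<^sub>2 * k21) * (\<eta>\<^sub>1 * k12 + \<eta>\<^sub>2 * k22) - (\<xi>\<^sub>1 * k12 + \<xi>\<^sub>2 * k22) * (\<eta>\<^sub>1 * k11 + \<eta>\<^sub>2 * k21)
    = (\<xi>\<^sub>1 * \<eta>\<^sub>2 - \<xi>\<^sub>2 * \<eta>\<^sub>1) * real_of_int (k11 * k22 - k12 * k21)"
    by (simp add: algebra_simps)
  then have Xi': "(\<xi>\<^sub>1 * k11 + \<xi>\<^sub>2 * k21) * (\<eta>\<^sub>1 * k12 + \<eta>\<^sub>2 * k22)
      - (\<xi>\<^sub>1 * k12 + \<xi>\<^sub>2 * k22) * (\<eta>\<^sub>1 * k11 + \<eta>\<^sub>2 * k21) = 1"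
    using Xi K by simp
  have \<rho>_pos: "\<And>X. X \<ge> 1 \<Longrightarrow> \<rho> X > 0"
    using assms(11) by (simp add: reciprocal_inverse_def)
  have \<rho>_le: "\<rho> X \<le> q" if "X \<ge> 1" "q \<ge> (1::int)" "\<bar>\<beta> / \<delta> * of_int q - of_int p\<bar> < 1 / X" for X and q p :: int
    by (rule reciprocal_inverse_le_denominator[OF assms(8,9,11,12) that])
  have "\<exists>C>0. \<forall>T\<ge>1. orbit_close \<alpha> \<beta> \<gamma> \<delta>
      (\<xi>\<^sub>1 * k11 + \<xi>\<^sub>2 * k21) (\<xi>\<^sub>1 * k12 + \<xi>\<^sub>2 * k22) (\<eta>\<^sub>1 * k11 + \<eta>\<^sub>2 * k21) (\<eta>\<^sub>1 * k12 + \<eta>\<^sub>2 * k22) T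
      (C * (T powr (r / (1 + r)) / \<rho> (T powr (1 / (1 + r)))))"
    by (rule orbit_close_positive[OF assms(3,1,2) g Xi' assms(6) pos \<rho>_pos]) (assumption, rule \<rho>_le)
  then obtain C where C: "C > 0" and close: "\<And>T. T \<ge> 1 \<Longrightarrow> orbit_close \<alpha> \<beta> \<gamma> \<delta>
      (\<xi>\<^sub>1 * k11 + \<xi>\<^sub>2 * k21) (\<xi>\<^sub>1 * k12 + \<xi>\<^sub>2 * k22) (\<eta>\<^sub>1 * k11 + \<eta>\<^sub>2 * k21) (\<eta>\<^sub>1 * k12 + \<eta>\<^sub>2 * k22) T
      (C * (T powr (r / (1 + r)) / \<rho> (T powr (1 / (1 + r)))))"
    by auto
  \<comment> \<open>The factor lost in undoing K; it is positive because K is not zero.\<close>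
  define c where "c = real_of_int (\<bar>k11\<bar> + \<bar>k12\<bar> + \<bar>k21\<bar> + \<bar>k22\<bar>)"
  have "k11 \<noteq> 0 \<or> k12 \<noteq> 0" using K by auto
  then have "c * C > 0" using C unfolding c_def by (intro mult_pos_pos) linarith+
  moreover have "\<exists>(L :: int^2^2) (t :: real). det L = 1 \<and> 1 \<le> \<bar>t\<bar> \<and> \<bar>t\<bar> \<le> T \<and>
           max_norm (mat2 1 t 0 1 ** mat2 \<alpha> \<gamma> \<beta> \<delta> ** map_matrix real_of_int L
                      - mat2 \<xi>\<^sub>1 \<xi>\<^sub>2 \<eta>\<^sub>1 \<eta>\<^sub>2)
             \<le> c * C * T powr (r / (1 + r)) / \<rho> (T powr (1 / (1 + r)))" if "T \<ge> 1" for T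
    using orbit_close_imp_max_norm[OF orbit_close_right_mult[OF close[OF that] K]]
    unfolding c_def by (simp only: mult.assoc times_divide_eq_right)
  ultimately show ?thesis by blast
qed

end
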